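(* Let $D(t)\in\mathbb{C}[t]$ be a nonconstant polynomial whose Pell equation has a fundamental solution $(u(t),v(t))$. Define $$R(D):=\{\alpha\in\mathbb{C} : (t-\alpha)^2 \mid v^{\mathrm{new}}_n(t)\text{ for some integer } n\geq 1\}.$$ Then $\# R(D)\leq \deg u-1$.
   Context: For $D\in\mathbb{C}[t]$ nonconstant, Pell's equation for $D$ is $x^2-Dy^2=1$ with $x,y\in\mathbb{C}[t]$. A fundamental solution is a solution $(u,v)$ with $v\neq 0$ of minimal degree among all solutions with $y\neq0$ (it is unique up to signs, and exists exactly when there is a solution with $y\ne 0$). For integers $n\geq 1$ define $u_n,v_n\in\mathbb{C}[t]$ by $u_n+v_n\sqrt{D}=(u+v\sqrt{D})^n$. The "new part" $v^{\mathrm{new}}_n\in\mathbb{C}[t]$ of $v_n$ is determined by $v_n=\prod_{m\mid n}v^{\mathrm{new}}_m$ for all $n\geq 1$; equivalently $v^{\mathrm{new}}_n=\prod_{m\mid n}v_m^{\mu(n/m)}$, where $\mu$ is the Möbius function (this is a polynomial; it collects, with multiplicity, the factors of $v_n$ that do not divide $v_m$ for any $1\le m<n$). *)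

theory Defs
  imports Complex_Main "HOL-Computational_Algebra.Computational_Algebra"
begin

definition pell :: "complex poly \<Rightarrow> complex poly \<Rightarrow> complex poly \<Rightarrow> bool" where
  "pell D x y \<longleftrightarrow> x ^ 2 - D * y ^ 2 = 1"

text \<open>
  The degree of a solution \<open>(x, y)\<close> is taken to be that of \<open>x\<close>. If \<open>y \<noteq> 0\<close> and \<open>D\<close> is nonconstant
  then \<open>2 * degree x = degree D + 2 * degree y\<close> (lemma \<open>pell_degree\<close>), so minimising
  the degree of \<open>y\<close> or the larger of the two degrees gives the same notion.
\<close>

definition fundamental_solution :: "complex poly \<Rightarrow> complex poly \<Rightarrow> complex poly \<Rightarrow> bool" where
  "fundamental_solution D u v \<longleftrightarrow>
     pell D u v \<and> v \<noteq> 0 \<and> (\<forall>x y. pell D x y \<and> y \<noteq> 0 \<longrightarrow> degree u \<le> degree x)"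

lemma pell_degree:
  assumes "degree D > 0" "pell D x y" "y \<noteq> 0"
  shows "2 * degree x = degree D + 2 * degree y"
proof -
  have D: "D \<noteq> 0" using assms(1) by auto
  have "x ^ 2 = D * y ^ 2 + 1"
    using assms(2) by (simp add: pell_def algebra_simps)
  moreover have "degree (D * y ^ 2) = degree D + 2 * degree y"
    using D assms(3) by (simp add: degree_mult_eq degree_power_eq)
  ultimately have "degree (x ^ 2) = degree D + 2 * degree y"
    using assms(1) by (simp add: degree_add_eq_left)
  moreover have "degree (x ^ 2) = 2 * degree x"
    by (cases "x = 0") (auto simp: degree_power_eq)
  ultimately show ?thesis by simp
qed

text \<open>
  The pair \<open>(a, b)\<close> stands for \<open>a + b * sqrt D\<close>, with multiplication determined by
  \<open>(sqrt D) ^ 2 = D\<close>.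
\<close>

definition quad_mult ::
  "complex poly \<Rightarrow> complex poly \<times> complex poly \<Rightarrow> complex poly \<times> complex poly
     \<Rightarrow> complex poly \<times> complex poly" where
  "quad_mult D p q =
     (fst p * fst q + D * snd p * snd q, fst p * snd q + snd p * fst q)"

primrec quad_pow ::
  "complex poly \<Rightarrow> complex poly \<times> complex poly \<Rightarrow> nat \<Rightarrow> complex poly \<times> complex poly" where
  "quad_pow D p 0 = (1, 0)"
| "quad_pow D p (Suc n) = quad_mult D p (quad_pow D p n)"

definition pell_u ::
  "complex poly \<Rightarrow> complex poly \<Rightarrow> complex poly \<Rightarrow> nat \<Rightarrow> complex poly" where
  "pell_u D u v n = fst (quad_pow D (u, v) n)"

definition pell_v ::
  "complex poly \<Rightarrow> complex poly \<Rightarrow> complex poly \<Rightarrow> nat \<Rightarrow> complex poly" where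
  "pell_v D u v n = snd (quad_pow D (u, v) n)"

lemma quad_pow_eval:
  assumes "s ^ 2 = poly D t"
  shows "poly (pell_u D u v n) t + poly (pell_v D u v n) t * s = (poly u t + poly v t * s) ^ n"
proof (induction n)
  case 0
  then show ?case by (simp add: pell_u_def pell_v_def)
next
  case (Suc n)
  have "poly D t = s * s" using assms by (simp add: power2_eq_square)
  then show ?case
    unfolding power_Suc Suc.IH [symmetric]
    by (simp add: pell_u_def pell_v_def quad_mult_def algebra_simps)
qed

text \<open>
  The relation \<open>v\<^sub>n = (\<Prod>m dvd n. vnew\<^sub>m)\<close> solved for the factor with \<open>m = n\<close>. The division
  is exact for a Pell solution: see \<open>prod_pell_new\<close> below, which recovers the relation, and
  \<open>pell_new_unique\<close>, which shows that the relation determines the new parts.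
\<close>

function pell_new ::
  "complex poly \<Rightarrow> complex poly \<Rightarrow> complex poly \<Rightarrow> nat \<Rightarrow> complex poly" where
  "pell_new D u v n = pell_v D u v n div (\<Prod>m | m dvd n \<and> m < n. pell_new D u v m)"
  by auto
termination
  by (relation "measure (\<lambda>(D, u, v, n). n)") auto

declare pell_new.simps [simp del]

definition pell_R :: "complex poly \<Rightarrow> complex poly \<Rightarrow> complex poly \<Rightarrow> complex set" where
  "pell_R D u v = {\<alpha>. \<exists>n\<ge>1. [:- \<alpha>, 1:] ^ 2 dvd pell_new D u v n}"


subsection \<open>The new parts are well defined\<close>

text \<open>
  With \<open>U\<^sub>n\<close> the Chebyshev polynomials of the second kind, \<open>cheb (n + 1) = U\<^sub>n\<close>. One has
  \<open>v\<^sub>n = v * cheb n (u)\<close>, and sorting the roots \<open>cos (k * pi / n)\<close> of \<open>cheb n\<close> by the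
  reduced denominator of \<open>k / n\<close> gives the factorisation of \<open>v\<^sub>n\<close> into new parts.
\<close>

fun cheb :: "nat \<Rightarrow> complex poly" where
  "cheb 0 = 0"
| "cheb (Suc 0) = 1"
| "cheb (Suc (Suc n)) = [:0, 2:] * cheb (Suc n) - cheb n"

lemma pell_v_rec:
  assumes "pell D u v"
  shows "pell_v D u v (Suc (Suc n)) = 2 * u * pell_v D u v (Suc n) - pell_v D u v n"
proof -
  obtain a b where ab: "quad_pow D (u, v) n = (a, b)" by fastforce
  have uu: "u * u = 1 + D * (v * v)"
    using assms by (simp add: pell_def power2_eq_square algebra_simps)
  have "pell_v D u v (Suc (Suc n)) - (2 * u * pell_v D u v (Suc n) - pell_v D u v n) =
      b * (1 + D * (v * v) - u * u)"
    by (simp add: pell_v_def quad_mult_def ab algebra_simps)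
  then show ?thesis by (simp add: uu)
qed

lemma pell_v_cheb:
  assumes "pell D u v"
  shows "pell_v D u v n = v * pcompose (cheb n) u"
proof (induction n rule: cheb.induct)
  case 1
  then show ?case by (simp add: pell_v_def)
next
  case 2
  then show ?case by (simp add: pell_v_def quad_mult_def pcompose_1)
next
  case (3 n)
  have "smult 2 p = 2 * p" for p :: "complex poly"
    by (simp add: numeral_poly)
  moreover have "pcompose 2 u = 2"
    by (simp add: numeral_poly pcompose_pCons)
  ultimately show ?case
    using 3 by (simp add: pell_v_rec [OF assms] pcompose_diff pcompose_mult pcompose_pCons algebra_simps)
qed

lemma cheb_degree: "degree (cheb (Suc n)) = n \<and> coeff (cheb (Suc n)) n = 2 ^ n"
proof (induction n rule: less_induct)
  case (less n)
  consider "n = 0" | m where "n = Suc m" by (cases n) auto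
  then show ?case
  proof cases
    case 1
    then show ?thesis by simp
  next
    case (2 m)
    have IH: "degree (cheb (Suc m)) = m" "coeff (cheb (Suc m)) m = 2 ^ m"
      using less 2 by auto
    have dm: "degree (cheb m) \<le> m"
      using less 2 by (cases m) (auto simp: le_Suc_eq)
    have c: "coeff (cheb (Suc n)) k = 2 * coeff (cheb (Suc m)) (k - 1) - coeff (cheb m) k"
      if "k \<ge> Suc m" for k
      using that by (cases k) (auto simp: 2 mult_pCons_left coeff_pCons)
    have top: "coeff (cheb (Suc n)) n = 2 ^ n"
      using c [of n] IH dm 2 by (simp add: coeff_eq_0)
    moreover have "degree (cheb (Suc n)) \<le> n"
    proof (rule degree_le, safe)
      fix k assume "n < k"
      then show "coeff (cheb (Suc n)) k = 0"
        using c [of k] IH dm 2 by (simp add: coeff_eq_0)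
    qed
    moreover have "n \<le> degree (cheb (Suc n))"
      using top by (intro le_degree) simp
    ultimately show ?thesis by simp
  qed
qed

lemma cheb_cos:
  "poly (cheb n) (complex_of_real (cos x)) * complex_of_real (sin x) = complex_of_real (sin (real n * x))"
proof (induction n rule: cheb.induct)
  case (3 n)
  have "sin (real (Suc (Suc n)) * x) = 2 * cos x * sin (real (Suc n) * x) - sin (real n * x)"
    using sin_add [of "real (Suc n) * x" x] sin_diff [of "real (Suc n) * x" x]
    by (simp add: algebra_simps)
  then have "complex_of_real (sin (real (Suc (Suc n)) * x)) =
      2 * complex_of_real (cos x) * complex_of_real (sin (real (Suc n) * x)) - complex_of_real (sin (real n * x))"
    by (simp only: of_real_mult of_real_diff of_real_numeral)
  moreover have "poly (cheb (Suc (Suc n))) (complex_of_real (cos x)) * complex_of_real (sin x) =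
      2 * complex_of_real (cos x) * (poly (cheb (Suc n)) (complex_of_real (cos x)) * complex_of_real (sin x))
      - poly (cheb n) (complex_of_real (cos x)) * complex_of_real (sin x)"
    by (simp add: algebra_simps)
  ultimately show ?case
    by (simp only: 3)
qed auto

definition cheb_factor :: "nat \<Rightarrow> nat \<Rightarrow> complex poly" where
  "cheb_factor k n = [:- 2 * complex_of_real (cos (real k / real n * pi)), 2:]"

lemma cheb_prod:
  assumes "n > 0"
  shows "cheb n = (\<Prod>k\<in>{0<..<n}. cheb_factor k n)"
proof -
  obtain m where m: "n = Suc m" using assms by (cases n) auto
  define P where "P = (\<Prod>k\<in>{0<..<n}. cheb_factor k n)"
  define z where "z k = complex_of_real (cos (real k / real n * pi))" for k
  have P: "degree P = m" "coeff P m = 2 ^ m"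
  proof -
    have nz: "cheb_factor k n \<noteq> 0" "degree (cheb_factor k n) = 1" 
      "lead_coeff (cheb_factor k n) = 2" for k
      by (auto simp: cheb_factor_def)
    have "degree P = (\<Sum>k\<in>{0<..<n}. degree (cheb_factor k n))"
      unfolding P_def by (rule degree_prod_eq_sum_degree) (simp add: nz)
    then show d: "degree P = m"
      unfolding nz by (simp add: m)
    have "lead_coeff P = 2 ^ m"
      unfolding P_def lead_coeff_prod nz(3) by (simp add: m)
    then show "coeff P m = 2 ^ m" by (simp add: d)
  qed
  have inj: "inj_on z {0<..<n}"
  proof (rule inj_onI)
    fix j k assume jk: "j \<in> {0<..<n}" "k \<in> {0<..<n}" "z j = z k"
    have "real j / real n * pi = real k / real n * pi"
    proof (rule cos_inj_pi)
      show "cos (real j / real n * pi) = cos (real k / real n * pi)"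
        using jk by (simp add: z_def)
    qed (use jk in \<open>auto simp: field_simps\<close>)
    then show "j = k" using assms by simp
  qed
  have roots: "poly (cheb n - P) (z k) = 0" if k: "k \<in> {0<..<n}" for k
  proof -
    have "0 < real k / real n * pi" "real k / real n * pi < pi"
      using k by (auto simp: field_simps)
    then have "sin (real k / real n * pi) \<noteq> 0"
      using sin_gt_zero by force
    moreover have "sin (real n * (real k / real n * pi)) = 0"
      using assms by (simp add: sin_npi)
    ultimately have "poly (cheb n) (z k) = 0"
      using cheb_cos [of n "real k / real n * pi"] by (auto simp: z_def)
    moreover have "poly P (z k) = 0"
      unfolding P_def poly_prod using k
      by (intro prod_zero) (auto simp: cheb_factor_def z_def intro!: bexI [of _ k])
    ultimately show ?thesis by simp
  qed
  have "cheb n - P = 0"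
  proof (rule ccontr)
    assume nz: "cheb n - P \<noteq> 0"
    have le: "degree (cheb n - P) \<le> m"
      using P cheb_degree [of m] by (intro degree_diff_le) (auto simp: m)
    have "coeff (cheb n - P) m = 0"
      using P cheb_degree [of m] by (simp add: m)
    then have "degree (cheb n - P) \<noteq> m"
      using nz by (metis leading_coeff_0_iff)
    with le have "degree (cheb n - P) < m" by simp
    moreover have "m = card (z ` {0<..<n})"
      using inj by (simp add: card_image m)
    moreover have "card (z ` {0<..<n}) \<le> card {x. poly (cheb n - P) x = 0}"
      using roots nz by (intro card_mono poly_roots_finite) auto
    moreover have "card {x. poly (cheb n - P) x = 0} \<le> degree (cheb n - P)"
      using nz by (rule card_poly_roots_bound)
    ultimately show False by simp
  qed
  then show ?thesis by (simp add: P_def)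
qed

lemma prod_reduced_fractions:
  fixes g :: "real \<Rightarrow> 'a :: comm_monoid_mult"
  assumes "n > 0"
  shows "(\<Prod>k\<in>{0<..<n}. g (real k / real n)) =
         (\<Prod>m | m dvd n. \<Prod>k | k \<in> {0<..<m} \<and> coprime k m. g (real k / real m))"
proof -
  have fin: "finite {m. m dvd n}" using assms by simp
  have "(\<Prod>m | m dvd n. \<Prod>k | k \<in> {0<..<m} \<and> coprime k m. g (real k / real m)) =
        (\<Prod>(m, k)\<in>(SIGMA m:{m. m dvd n}. {k. k \<in> {0<..<m} \<and> coprime k m}). g (real k / real m))"
    using fin by (subst prod.Sigma) auto
  also have "\<dots> = (\<Prod>k\<in>{0<..<n}. g (real k / real n))"
  proof (rule prod.reindex_bij_witness
      [of _ "\<lambda>k. (n div gcd k n, k div gcd k n)" "\<lambda>(m, k). k * (n div m)"], goal_cases)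
    case (1 a)
    then obtain m k where a: "a = (m, k)" "m dvd n" "0 < k" "k < m" "coprime k m" by auto
    obtain d where d: "n = m * d" using a by blast
    have dp: "d > 0" "m > 0" using assms d by auto
    have "gcd (k * d) (m * d) = d"
      using a by (simp add: gcd_mult_distrib_nat [symmetric] gcd_mult_right mult.commute coprime_iff_gcd_eq_1)
    then show ?case using a d dp by simp
  next
    case (2 a)
    then obtain m k where a: "a = (m, k)" "m dvd n" "0 < k" "k < m" "coprime k m" by auto
    obtain d where d: "n = m * d" using a by blast
    have dp: "d > 0" "m > 0" using assms d by auto
    then show ?case using a d by simp
  next
    case (3 b)
    obtain c where c: "n = gcd b n * c" by (rule dvdE [of "gcd b n" n]) auto
    have g: "gcd b n > 0" using assms by simp
    have "c > 0" using assms c by (cases c) auto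
    have "n div gcd b n = c" using g by (subst c) simp
    moreover have "n div c = gcd b n" using \<open>c > 0\<close> by (subst c) simp
    ultimately show ?case by simp
  next
    case (4 b)
    have g: "gcd b n > 0" using assms by simp
    have "b div gcd b n * gcd b n = b" and *: "n div gcd b n * gcd b n = n" by auto
    moreover have "0 < b" "b < n" using 4 by auto
    ultimately have "b div gcd b n * gcd b n < n div gcd b n * gcd b n" "b div gcd b n \<noteq> 0"
      by (simp, intro notI, simp)
    then have "b div gcd b n < n div gcd b n" "0 < b div gcd b n"
      by (metis mult_less_cancel2, simp)
    moreover have "coprime (b div gcd b n) (n div gcd b n)"
      using assms by (intro div_gcd_coprime) auto
    moreover have "n div gcd b n dvd n"
      using * by (metis dvd_triv_left)
    ultimately show ?case by auto
  next
    case (5 a)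
    then obtain m k where a: "a = (m, k)" "m dvd n" "0 < k" "k < m" "coprime k m" by auto
    obtain d where d: "n = m * d" using a by blast
    have dp: "d > 0" "m > 0" using assms d by auto
    then show ?case using a d by simp
  qed
  finally show ?thesis by simp
qed

lemma pell_v_nonzero:
  assumes "degree D > 0" "pell D u v" "v \<noteq> 0" "n > 0"
  shows "pell_v D u v n \<noteq> 0"
proof -
  have "degree u > 0" using pell_degree [OF assms(1-3)] assms(1) by simp
  moreover have "cheb n \<noteq> 0"
    using cheb_degree [of "n - 1"] assms(4) by (cases n) auto
  ultimately show ?thesis
    using assms(3) by (simp add: pell_v_cheb [OF assms(2)] pcompose_eq_0_iff)
qed

lemma pell_new_unique:
  assumes "degree D > 0" "pell D u v" "v \<noteq> 0"
    and w: "\<And>n. n \<ge> 1 \<Longrightarrow> pell_v D u v n = (\<Prod>m | m dvd n. w m)"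
    and "n \<ge> 1"
  shows "w n = pell_new D u v n"
  using \<open>n \<ge> 1\<close>
proof (induction n rule: less_induct)
  case (less n)
  define P where "P = (\<Prod>m | m dvd n \<and> m < n. w m)"
  have fin: "finite {m. m dvd n \<and> m < n}" by simp
  have "{m. m dvd n} = insert n {m. m dvd n \<and> m < n}"
    using less.prems by (auto dest: dvd_imp_le)
  then have vn: "pell_v D u v n = w n * P"
    using w [OF less.prems] fin by (simp add: P_def)
  then have "P \<noteq> 0"
    using pell_v_nonzero [OF assms(1-3), of n] less.prems by auto
  moreover have "P = (\<Prod>m | m dvd n \<and> m < n. pell_new D u v m)"
    unfolding P_def
  proof (rule prod.cong [OF refl])
    fix m assume "m \<in> {m. m dvd n \<and> m < n}"
    then have "m < n" "m \<ge> 1" using less.prems by (cases m; force)+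
    then show "w m = pell_new D u v m" by (rule less.IH)
  qed
  ultimately show ?case
    using vn by (subst pell_new.simps) simp
qed

lemma prod_pell_new:
  assumes "degree D > 0" "pell D u v" "v \<noteq> 0" "n \<ge> 1"
  shows "pell_v D u v n = (\<Prod>m | m dvd n. pell_new D u v m)"
proof -
  define g where "g x = pcompose [:- 2 * complex_of_real (cos (x * pi)), 2:] u" for x :: real
  define w where "w m = (if m = 1 then v
      else \<Prod>k | k \<in> {0<..<m} \<and> coprime k m. g (real k / real m))" for m :: nat
  have w: "pell_v D u v n = (\<Prod>m | m dvd n. w m)" if n: "n \<ge> 1" for n
  proof -
    have fin: "finite {m. m dvd n}" using n by simp
    have "pell_v D u v n = v * (\<Prod>k\<in>{0<..<n}. g (real k / real n))"
      using n by (simp add: pell_v_cheb [OF assms(2)] cheb_prod pcompose_prod cheb_factor_def g_def)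
    also have "\<dots> = v * (\<Prod>m | m dvd n. \<Prod>k | k \<in> {0<..<m} \<and> coprime k m. g (real k / real m))"
      using n by (simp add: prod_reduced_fractions)
    also have "(\<Prod>m | m dvd n. \<Prod>k | k \<in> {0<..<m} \<and> coprime k m. g (real k / real m))
        = (\<Prod>m\<in>{m. m dvd n} - {1}. w m)"
    proof (rule prod.mono_neutral_cong_right [OF fin])
      show "\<forall>m\<in>{m. m dvd n} - ({m. m dvd n} - {1}).
          (\<Prod>k | k \<in> {0<..<m} \<and> coprime k m. g (real k / real m)) = 1"
        by (intro ballI prod.neutral) auto
    qed (auto simp: w_def)
    also have "v * \<dots> = (\<Prod>m | m dvd n. w m)"
      using prod.remove [OF fin, of 1 w] by (simp add: w_def)
    finally show ?thesis .
  qed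
  have "(\<Prod>m | m dvd n. w m) = (\<Prod>m | m dvd n. pell_new D u v m)"
  proof (rule prod.cong [OF refl])
    fix m assume "m \<in> {m. m dvd n}"
    then have "m \<ge> 1" using assms(4) by (cases m) auto
    then show "w m = pell_new D u v m" using pell_new_unique [OF assms(1-3) w] by blast
  qed
  then show ?thesis using w [OF assms(4)] by simp
qed

end

theory Submission imports Defs begin

text \<open>
  Let \<open>\<alpha>\<close> be a double root of a new part, hence of some \<open>v\<^sub>n\<close>. Extend \<open>d/dt\<close> to
  \<open>\<complex>(t)(\<surd>D)\<close> and apply it to \<open>w = u + v \<surd>D\<close>. As \<open>w\<close> has norm \<open>1\<close>, its logarithmic derivative
  is \<open>u' / (v \<surd>D)\<close>, so that of \<open>w\<^sup>n\<close> is \<open>n u' / (v \<surd>D)\<close>. Comparing coefficients in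
  \<open>(w\<^sup>n)' = n u' w\<^sup>n / (v \<surd>D)\<close> gives \<open>v (D' v\<^sub>n + 2 D v\<^sub>n') = 2 n u' u\<^sub>n\<close>. The left-hand side
  vanishes at \<open>\<alpha>\<close>, while \<open>u\<^sub>n\<close> does not because \<open>u\<^sub>n\<^sup>2 = 1 + D v\<^sub>n\<^sup>2\<close>. So \<open>\<alpha>\<close> is one of the
  at most \<open>deg u - 1\<close> roots of \<open>u'\<close>.
\<close>

lemma pell_pderiv:
  assumes "pell D u v"
  shows "v * (pderiv D * v + 2 * D * pderiv v) = 2 * u * pderiv u"
proof -
  have "pderiv (u * u) = pderiv (1 + D * (v * v))"
    using assms by (simp add: pell_def power2_eq_square algebra_simps)
  then show ?thesis
    by (simp add: pderiv_mult pderiv_add algebra_simps flip: mult_2)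
qed

lemma pell_u_v_Suc:
  "pell_u D u v (Suc n) = u * pell_u D u v n + D * v * pell_v D u v n"
  "pell_v D u v (Suc n) = u * pell_v D u v n + v * pell_u D u v n"
  by (simp_all add: pell_u_def pell_v_def quad_mult_def)

text \<open>The two coordinates of \<open>(w^n)' = n u' w^n / (v sqrt D)\<close>, cleared of
  denominators. The induction step for each identity uses both.\<close>

lemma pderiv_pell_u_v:
  assumes "pell D u v"
  shows "v * pderiv (pell_u D u v n) = of_nat n * pderiv u * pell_v D u v n \<and>
    v * (pderiv D * pell_v D u v n + 2 * D * pderiv (pell_v D u v n)) =
      2 * of_nat n * pderiv u * pell_u D u v n"
proof (induction n)
  case 0
  then show ?case by (simp add: pell_u_def pell_v_def)
next
  case (Suc n)
  define a b where "a = pell_u D u v n" and "b = pell_v D u v n"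
  have rec: "pell_u D u v (Suc n) = u * a + D * v * b" "pell_v D u v (Suc n) = u * b + v * a"
    by (simp_all add: pell_u_v_Suc a_def b_def)
  have da: "v * pderiv a = of_nat n * pderiv u * b"
    and db: "v * (pderiv D * b + 2 * D * pderiv b) = 2 * of_nat n * pderiv u * a"
    using Suc by (simp_all add: a_def b_def)
  note dv = pell_pderiv [OF assms]
  \<comment> \<open>Doubling lets the \<open>pderiv D\<close> term be shared equally between the
    groupings of \<open>db\<close> and \<open>dv\<close>.\<close>
  have "2 * (v * pderiv (u * a + D * v * b)) =
      2 * pderiv u * v * a + 2 * u * (v * pderiv a)
      + v * (v * (pderiv D * b + 2 * D * pderiv b)) + b * (v * (pderiv D * v + 2 * D * pderiv v))"
    by (simp add: pderiv_mult pderiv_add algebra_simps)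
  also have "\<dots> = 2 * (of_nat (Suc n) * pderiv u * (u * b + v * a))"
    unfolding da db dv by (simp add: algebra_simps)
  finally have 1: "v * pderiv (u * a + D * v * b) = of_nat (Suc n) * pderiv u * (u * b + v * a)"
    by simp
  have "v * (pderiv D * (u * b + v * a) + 2 * D * pderiv (u * b + v * a)) =
      u * (v * (pderiv D * b + 2 * D * pderiv b)) + a * (v * (pderiv D * v + 2 * D * pderiv v))
      + 2 * D * v * pderiv u * b + 2 * D * v * (v * pderiv a)"
    by (simp add: pderiv_mult pderiv_add algebra_simps)
  also have "\<dots> = 2 * of_nat (Suc n) * pderiv u * (u * a + D * v * b)"
    unfolding da db dv by (simp add: algebra_simps)
  finally show ?case
    unfolding rec using 1 by blast
qed

text \<open>The norm \<open>x^2 - D y^2\<close> is multiplicative, so powers of a norm 1 element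
  have norm 1.\<close>

lemma pell_pell_u_v:
  assumes "pell D u v"
  shows "pell D (pell_u D u v n) (pell_v D u v n)"
proof (induction n)
  case 0
  then show ?case by (simp add: pell_def pell_u_def pell_v_def)
next
  case (Suc n)
  have "(u * a + D * v * b)\<^sup>2 - D * (u * b + v * a)\<^sup>2 = (u\<^sup>2 - D * v\<^sup>2) * (a\<^sup>2 - D * b\<^sup>2)" for a b
    by (simp add: power2_eq_square algebra_simps)
  then show ?case
    using assms Suc by (simp add: pell_def pell_u_v_Suc)
qed

lemma double_root_pell_v:
  assumes "pell D u v" "n \<ge> 1" "[:- \<alpha>, 1:]\<^sup>2 dvd pell_v D u v n"
  shows "poly (pderiv u) \<alpha> = 0"
proof -
  obtain q where q: "pell_v D u v n = [:- \<alpha>, 1:]\<^sup>2 * q" using assms(3) by blast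
  have "poly (pell_v D u v n) \<alpha> = 0" "poly (pderiv (pell_v D u v n)) \<alpha> = 0"
    by (simp_all add: q pderiv_mult pderiv_power_Suc power2_eq_square del: mult_pCons_left mult_pCons_right)
  moreover from this(1) have "poly (pell_u D u v n) \<alpha> \<noteq> 0"
    using arg_cong [OF pell_pell_u_v [OF assms(1), of n, unfolded pell_def], of "\<lambda>p. poly p \<alpha>"]
    by auto
  \<comment> \<open>At \<alpha> the second identity reads \<open>0 = 2 n u' u_n\<close>, and
    \<open>n \<ge> 1\<close> makes \<open>2 n\<close> nonzero.\<close>
  ultimately show ?thesis
    using arg_cong [OF conjunct2 [OF pderiv_pell_u_v [OF assms(1), of n]], of "\<lambda>p. poly p \<alpha>"]
      assms(2)
    by (simp add: of_nat_poly)
qed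

theorem theorem0p1:
  fixes D u v :: "complex poly"
  assumes "degree D > 0"
    and "fundamental_solution D u v"
  shows "finite (pell_R D u v) \<and> int (card (pell_R D u v)) \<le> int (degree u) - 1"
proof -
  have uv: "pell D u v" "v \<noteq> 0"
    using assms(2) by (auto simp: fundamental_solution_def)
  have du: "degree u > 0"
    using pell_degree [OF assms(1) uv] assms(1) by simp
  then have nz: "pderiv u \<noteq> 0"
    by (simp add: pderiv_eq_0_iff)
  have "pell_R D u v \<subseteq> {\<alpha>. poly (pderiv u) \<alpha> = 0}"
  proof
    fix \<alpha> assume "\<alpha> \<in> pell_R D u v"
    then obtain n where n: "n \<ge> 1" "[:- \<alpha>, 1:]\<^sup>2 dvd pell_new D u v n"
      by (auto simp: pell_R_def)
    have "pell_new D u v n dvd pell_v D u v n"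
      unfolding prod_pell_new [OF assms(1) uv n(1)] using n(1) by (intro dvd_prodI) auto
    then show "\<alpha> \<in> {\<alpha>. poly (pderiv u) \<alpha> = 0}"
      using double_root_pell_v [OF uv(1) n(1)] dvd_trans [OF n(2)] by simp
  qed
  moreover have "finite {\<alpha>. poly (pderiv u) \<alpha> = 0}"
    using nz by (rule poly_roots_finite)
  moreover have "card {\<alpha>. poly (pderiv u) \<alpha> = 0} \<le> degree u - 1"
    using card_poly_roots_bound [OF nz] by (simp add: degree_pderiv)
  ultimately have "finite (pell_R D u v)" "card (pell_R D u v) \<le> degree u - 1"
    by (auto intro: finite_subset order_trans [OF card_mono])
  \<comment> \<open>As \<open>degree u > 0\<close>, truncated and integer subtraction agree.\<close>
  then show ?thesis
    using du by simp
qed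

end
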